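(* Let $(G,Q)$ be an instance of the QCCP. The optimal value of the linear program $(CGL_{ILP})$ equals the Gilmore-Lawler type bound $v_{GL}$.
   Context: An instance of the QCCP (quadratic cycle cover problem, minimize $x^TQx$ over $x\in X$) is a pair $(G,Q)$ with $G=(N,A)$ a directed graph, $A\subseteq N\times N$, $|N|=n$, $|A|=m$, and $Q\in\mathbb{R}^{m\times m}$ indexed by arcs, with $Q_{ef}=0$ if the starting node of $f$ is not the ending node of $e$ (except that linear arc costs may be placed on the diagonal). For $i\in N$, $\delta^+(i)$ and $\delta^-(i)$ are the sets of arcs leaving and entering $i$. The set of cycle covers is $$X=\Big\{x\in\{0,1\}^m : \sum_{e\in\delta^+(i)}x_e=\sum_{e\in\delta^-(i)}x_e=1\ \ \forall i\in N\Big\}.$$ Gilmore-Lawler type bound: for $e\in A$ let $Q_{e,:}$ be the $e$th row of $Q$ and $z_e:=\min\{Q_{e,:}x : x\in X,\ x_e=1\}$, with $z_e:=0$ if this feasible set is empty; let $z=(z_e)_{e\in A}$ and $v_{GL}:=\min\{z^Tx : x\in X\}$ (the minimum over an empty set is $+\infty$). $(CGL_{ILP})$ is the linear program in variables $x=(x_e)_{e\in A}$ and $y=(y_{ef})_{e,f\in A}$: $$\min\ \sum_{e\in A}\sum_{f\in A}Q_{ef}y_{ef}$$ subject to $\sum_{f\in\delta^+(i)}y_{ef}=\sum_{f\in\delta^-(i)}y_{ef}=x_e$ for all $i\in N$, $e\in A$; $\ y_{ee}=x_e$ for all $e\in A$; $\ \sum_{e\in\delta^+(i)}x_e=\sum_{e\in\delta^-(i)}x_e=1$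 for all $i\in N$; $\ x_e\ge0$, $y_{ef}\ge 0$ for all $e,f\in A$. It is the continuous relaxation of the integer program with the additional constraints $x_e\in\{0,1\}$, $y_{ef}\in\{0,1\}$. *)

theory Defs
  imports
    "HOL-Analysis.Analysis"
    "Graph_Theory.Pair_Digraph"
begin

text \<open>
  The arcs of a \<^typ>\<open>'a pair_pre_digraph\<close> are pairs \<open>(tail, head)\<close>, and the locale
  \<^locale>\<open>pair_fin_digraph\<close> says that nodes and arcs are finite in number and that every arc
  joins two nodes; loops are allowed. The sets of arcs leaving and entering \<open>i\<close> are
  \<open>out_arcs G i\<close> and \<open>in_arcs G i\<close>, where the coercion from pair digraphs to digraphs is
  inserted by the parser. Vectors and matrices indexed by arcs are real functions on pairs
  of nodes; those that range over feasible sets are \<open>undefined\<close> off the arc set, so that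
  each of them corresponds to exactly one vector indexed by the arcs.
\<close>

locale qccp_instance = pair_fin_digraph G
  for G :: "'a pair_pre_digraph" +
  fixes Q :: "'a \<times> 'a \<Rightarrow> 'a \<times> 'a \<Rightarrow> real"
  assumes Q_nonsuccessive:
    "\<lbrakk>e \<in> parcs G; f \<in> parcs G; e \<noteq> f; fst f \<noteq> snd e\<rbrakk> \<Longrightarrow> Q e f = 0"

definition cycle_covers :: "'a pair_pre_digraph \<Rightarrow> ('a \<times> 'a \<Rightarrow> real) set" where
  "cycle_covers G =
    {x \<in> parcs G \<rightarrow>\<^sub>E {0, 1}.
       \<forall>i \<in> pverts G. (\<Sum>e \<in> out_arcs G i. x e) = 1 \<and> (\<Sum>e \<in> in_arcs G i. x e) = 1}"

definition gl_coeff ::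
  "'a pair_pre_digraph \<Rightarrow> ('a \<times> 'a \<Rightarrow> 'a \<times> 'a \<Rightarrow> real) \<Rightarrow> 'a \<times> 'a \<Rightarrow> real" where
  "gl_coeff G Q e =
    (if {x \<in> cycle_covers G. x e = 1} = {} then 0
     else Min ((\<lambda>x. \<Sum>f \<in> parcs G. Q e f * x f) ` {x \<in> cycle_covers G. x e = 1}))"

definition v_GL ::
  "'a pair_pre_digraph \<Rightarrow> ('a \<times> 'a \<Rightarrow> 'a \<times> 'a \<Rightarrow> real) \<Rightarrow> ereal" where
  "v_GL G Q =
    (if cycle_covers G = {} then \<infinity>
     else ereal (Min ((\<lambda>x. \<Sum>e \<in> parcs G. gl_coeff G Q e * x e) ` cycle_covers G)))"

definition cgl_feasible ::
  "'a pair_pre_digraph \<Rightarrow> (('a \<times> 'a \<Rightarrow> real) \<times> ('a \<times> 'a \<Rightarrow> 'a \<times> 'a \<Rightarrow> real)) set" where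
  "cgl_feasible G =
    {(x, y). x \<in> parcs G \<rightarrow>\<^sub>E {0..} \<and> y \<in> parcs G \<rightarrow>\<^sub>E (parcs G \<rightarrow>\<^sub>E {0..}) \<and>
       (\<forall>i \<in> pverts G. \<forall>e \<in> parcs G.
          (\<Sum>f \<in> out_arcs G i. y e f) = x e \<and> (\<Sum>f \<in> in_arcs G i. y e f) = x e) \<and>
       (\<forall>e \<in> parcs G. y e e = x e) \<and>
       (\<forall>i \<in> pverts G.
          (\<Sum>e \<in> out_arcs G i. x e) = 1 \<and> (\<Sum>e \<in> in_arcs G i. x e) = 1)}"

text \<open>
  The optimal value is an infimum in the extended reals; it is \<open>\<infinity>\<close> if the linear program
  is infeasible.
\<close>

definition cgl_value ::
  "'a pair_pre_digraph \<Rightarrow> ('a \<times> 'a \<Rightarrow> 'a \<times> 'a \<Rightarrow> real) \<Rightarrow> ereal" where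
  "cgl_value G Q =
    (INF (x, y) \<in> cgl_feasible G. ereal (\<Sum>e \<in> parcs G. \<Sum>f \<in> parcs G. Q e f * y e f))"

end

theory Submission
  imports Defs
begin

text \<open>
  For fixed \<open>x\<close> the linear program splits into one problem per arc \<open>e\<close>: the row of \<open>e\<close> in \<open>y\<close> has
  to be \<open>x e\<close> times a fractional cycle cover with value \<open>1\<close> at \<open>e\<close>, at cost given by the row of
  \<open>e\<close> in \<open>Q\<close>. Cycle covers are perfect matchings between the tails and the heads of arcs, and by
  Birkhoff's theorem the bipartite matching polytope is integral. Hence the best row for \<open>e\<close>
  costs \<open>x e\<close> times the Gilmore-Lawler coefficient of \<open>e\<close>
  (\<open>gl_coeff_mult_le_scaled_cover\<close>), and by integrality again the remaining minimization over
  fractional \<open>x\<close> has a cycle cover as optimal solution. This gives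
  \<open>v_GL_le_cgl_objective\<close>; the opposite inequality comes from assembling optimal covers
  into a feasible point (\<open>cover_cost_attained_in_cgl\<close>).

  Integrality is used in the form of \<open>fractional_cover_rounding\<close>: every fractional cycle
  cover can be replaced, without raising a given linear cost and without enlarging its support,
  by a cycle cover. It is proved by cancelling alternating cycles of fractional arcs one
  after another (\<open>exists_zero_margin_perturbation\<close>).
\<close>

section \<open>Alternating cycles in bipartite graphs\<close>

text \<open>
  Read a pair as an edge between a left node (its first component) and a right node (its
  second component). If no edge is the only one at either of its ends, then one can walk
  through the graph without turning back, and the walk eventually closes a cycle. Giving the
  edges of that cycle the weights \<open>1\<close> and \<open>-1\<close> alternately yields \<open>d\<close>.
\<close>

lemma exists_zero_margin_perturbation:
  fixes F :: "('a \<times> 'b) set"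
  assumes fin: "finite F" and ne: "F \<noteq> {}"
    and tails: "\<And>e. e \<in> F \<Longrightarrow> \<exists>f\<in>F. f \<noteq> e \<and> fst f = fst e"
    and heads: "\<And>e. e \<in> F \<Longrightarrow> \<exists>f\<in>F. f \<noteq> e \<and> snd f = snd e"
  shows "\<exists>d :: 'a \<times> 'b \<Rightarrow> real. (\<exists>e. d e \<noteq> 0) \<and> (\<forall>e. e \<notin> F \<longrightarrow> d e = 0) \<and>
    (\<forall>i. (\<Sum>e | e \<in> F \<and> fst e = i. d e) = 0) \<and> (\<forall>i. (\<Sum>e | e \<in> F \<and> snd e = i. d e) = 0)"
proof -
  obtain a where a: "\<And>e. e \<in> F \<Longrightarrow> a e \<in> F \<and> a e \<noteq> e \<and> fst (a e) = fst e"
    using tails by metis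
  obtain b where b: "\<And>e. e \<in> F \<Longrightarrow> b e \<in> F \<and> b e \<noteq> e \<and> snd (b e) = snd e"
    using heads by metis
  obtain e1 where e1: "e1 \<in> F" using ne by auto
  \<comment> \<open>The walk \<open>q 0, p 0, q 1, p 1, \<dots>\<close> changes the right end from \<open>q k\<close> to \<open>p k\<close> and the
    left end from \<open>p k\<close> to \<open>q (Suc k)\<close>.\<close>
  define q where "q k = ((b \<circ> a) ^^ k) e1" for k
  define p where "p k = a (q k)" for k
  have q_Suc: "q (Suc k) = b (p k)" for k by (simp add: q_def p_def)
  have qF: "q k \<in> F" for k
    by (induction k) (use e1 a b in \<open>auto simp: q_def\<close>)
  have pF: "p k \<in> F" and pq: "p k \<noteq> q k" and fst_p: "fst (p k) = fst (q k)" for k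
    using a[OF qF[of k]] by (auto simp: p_def)
  have snd_q: "snd (q (Suc k)) = snd (p k)" and qp: "q (Suc k) \<noteq> p k" for k
    using b[OF pF[of k]] by (auto simp: q_Suc)
  define u where "u k = fst (q k)" for k
  define rep where "rep j \<longleftrightarrow> (\<exists>i<j. u i = u j)" for j
  have "range u \<subseteq> fst ` F" using qF by (auto simp: u_def)
  then have "\<not> inj u"
    using fin finite_subset finite_imageD[of u UNIV] by auto
  then obtain k l where "k < l" "u k = u l"
    unfolding inj_def by (metis linorder_neqE_nat)
  then have "rep l" by (auto simp: rep_def)
  then have "\<exists>j. rep j" by blast
  \<comment> \<open>The first return to a left node makes the left nodes \<open>u i, \<dots>, u (j - 1)\<close> distinct. For an
    arbitrary closed stretch of the walk the signed weights might cancel out.\<close>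
  define j where "j = (LEAST j. rep j)"
  have least: "\<not> rep l" if "l < j" for l
    using that unfolding j_def by (rule not_less_Least)
  have "rep j" unfolding j_def using \<open>\<exists>j. rep j\<close> by (rule LeastI_ex)
  then obtain i where i: "i < j" "u i = u j" by (auto simp: rep_def)
  have inj: "k = l" if "u k = u l" "k < j" "l < j" for k l
    using that least[of k] least[of l] by (cases k l rule: linorder_cases) (auto simp: rep_def)
  have "u (Suc i) \<noteq> u i"
    using snd_q[of i] qp[of i] fst_p[of i] by (auto simp: u_def prod_eq_iff)
  then have ij: "Suc i < j" using i by (metis Suc_lessI)
  define d :: "'a \<times> 'b \<Rightarrow> real"
    where "d e = (\<Sum>k=i..<j. of_bool (e = p k) - of_bool (e = q (Suc k)))" for e
  have sum_d: "(\<Sum>e | e \<in> F \<and> P e. d e) = (\<Sum>k=i..<j. of_bool (P (p k)) - of_bool (P (q (Suc k))))" for P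
  proof -
    have one: "(\<Sum>e | e \<in> F \<and> P e. of_bool (e = c) :: real) = of_bool (P c)" if "c \<in> F" for c
      using that fin by (auto simp: of_bool_def sum.delta)
    show ?thesis unfolding d_def
      by (subst sum.swap) (simp add: sum_subtractf one pF qF)
  qed
  show ?thesis
  proof (intro exI conjI allI impI)
    \<comment> \<open>The edges of the cycle at \<open>u (Suc i)\<close> are \<open>q (Suc i)\<close> and \<open>p (Suc i)\<close>. As \<open>Suc i < j\<close>, the
      second one occurs exactly once with weight \<open>1\<close>, and never with weight \<open>-1\<close>.\<close>
    have "d (p (Suc i)) = (\<Sum>k=i..<j. of_bool (k = Suc i))"
      unfolding d_def
    proof (rule sum.cong)
      fix k assume k: "k \<in> {i..<j}"
      have "p (Suc i) = p k \<longleftrightarrow> k = Suc i"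
        using inj[of k "Suc i"] k ij fst_p by (metis atLeastLessThan_iff u_def)
      moreover have "p (Suc i) \<noteq> q (Suc k)"
      proof
        assume eq: "p (Suc i) = q (Suc k)"
        then have "u (Suc i) = u (Suc k)" using fst_p[of "Suc i"] by (simp add: u_def)
        moreover have "Suc k \<noteq> j"
          using calculation i inj[of i "Suc i"] ij by auto
        ultimately have "Suc k = Suc i" using inj[of "Suc i" "Suc k"] ij k by auto
        with eq pq show False by metis
      qed
      ultimately show "of_bool (p (Suc i) = p k) - of_bool (p (Suc i) = q (Suc k)) = (of_bool (k = Suc i) :: real)"
        by simp
    qed simp
    also have "\<dots> = 1" using ij by (simp add: of_bool_def)
    finally show "d (p (Suc i)) \<noteq> 0" by simp
    show "d e = 0" if "e \<notin> F" for e
      unfolding d_def by (rule sum.neutral) (use that pF qF in auto)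
    show "(\<Sum>e | e \<in> F \<and> fst e = v. d e) = 0" for v
    proof -
      have "(\<Sum>e | e \<in> F \<and> fst e = v. d e)
          = - (\<Sum>k=i..<j. of_bool (u (Suc k) = v) - of_bool (u k = v))"
        by (simp add: sum_d fst_p flip: u_def sum_negf)
      then show ?thesis
        using i sum_Suc_diff'[of i j "\<lambda>k. of_bool (u k = v) :: real"] by simp
    qed
    show "(\<Sum>e | e \<in> F \<and> snd e = v. d e) = 0" for v
      by (simp add: sum_d snd_q)
  qed
qed

section \<open>Rounding fractional cycle covers\<close>

definition fractional_covers :: "'a pair_pre_digraph \<Rightarrow> ('a \<times> 'a \<Rightarrow> real) set" where
  "fractional_covers G =
    {x. (\<forall>e \<in> parcs G. 0 \<le> x e) \<and>
       (\<forall>i \<in> pverts G. (\<Sum>e \<in> out_arcs G i. x e) = 1 \<and> (\<Sum>e \<in> in_arcs G i. x e) = 1)}"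

lemma out_arcs_eq: "out_arcs (with_proj G) i = {e. e \<in> parcs G \<and> fst e = i}"
  and in_arcs_eq: "in_arcs (with_proj G) i = {e. e \<in> parcs G \<and> snd e = i}"
  by (auto simp: out_arcs_def in_arcs_def)

lemma other_fractional_summand:
  fixes x :: "'b \<Rightarrow> real"
  assumes "finite S" "(\<Sum>e\<in>S. x e) = 1" "\<And>e. e \<in> S \<Longrightarrow> 0 \<le> x e" "e \<in> S" "0 < x e" "x e < 1"
  shows "\<exists>f\<in>S. f \<noteq> e \<and> 0 < x f \<and> x f < 1"
proof -
  have split: "x e + sum x (S - {e}) = 1" using assms by (simp add: sum.remove)
  then have "sum x (S - {e}) > 0" using assms by simp
  then obtain f where f: "f \<in> S - {e}" "0 < x f"
    by (metis linorder_not_le sum_nonpos)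
  have "x f \<le> sum x (S - {e})"
    using f assms by (intro member_le_sum) auto
  then show ?thesis using f split assms by (intro bexI[of _ f]) auto
qed

context pair_fin_digraph
begin

lemma parc_ends: "e \<in> parcs G \<Longrightarrow> fst e \<in> pverts G \<and> snd e \<in> pverts G"
  using arc_fst_in_verts arc_snd_in_verts by auto

text \<open>
  A node that meets a fractional arc meets a second one on the same side, since the values on
  that side add up to \<open>1\<close>. So the fractional arcs, seen as edges between copies of their tails
  and heads, carry a perturbation with zero margins. One of its two signs does not increase
  the cost; moving in that direction until the first arc drops to \<open>0\<close> stays in the polytope
  and shrinks the support.
\<close>

lemma fractional_cover_improvement:
  fixes w :: "'a \<times> 'a \<Rightarrow> real"
  assumes x: "x \<in> fractional_covers G" and nonint: "\<exists>e\<in>parcs G. x e \<noteq> 0 \<and> x e \<noteq> 1"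
  obtains x' where "x' \<in> fractional_covers G"
    "{e \<in> parcs G. x' e \<noteq> 0} \<subset> {e \<in> parcs G. x e \<noteq> 0}"
    "(\<Sum>e\<in>parcs G. w e * x' e) \<le> (\<Sum>e\<in>parcs G. w e * x e)"
proof -
  let ?A = "parcs G"
  define F where "F = {e \<in> ?A. 0 < x e \<and> x e < 1}"
  have finA: "finite ?A" by (rule pair_finite_arcs)
  have nonneg: "0 \<le> x e" if "e \<in> ?A" for e using x that by (simp add: fractional_covers_def)
  have outs: "(\<Sum>e | e \<in> ?A \<and> fst e = i. x e) = 1"
    and ins: "(\<Sum>e | e \<in> ?A \<and> snd e = i. x e) = 1" if "i \<in> pverts G" for i
    using x that by (auto simp: fractional_covers_def out_arcs_eq in_arcs_eq)
  have le1: "x e \<le> 1" if "e \<in> ?A" for e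
  proof -
    have "x e \<le> (\<Sum>f | f \<in> ?A \<and> fst f = fst e. x f)"
      by (rule member_le_sum) (use that nonneg finA in auto)
    then show ?thesis using outs parc_ends that by simp
  qed
  have "finite F" using finA by (simp add: F_def)
  moreover have "F \<noteq> {}" using nonint nonneg le1 by (force simp: F_def)
  moreover have "\<exists>f\<in>F. f \<noteq> e \<and> fst f = fst e" if "e \<in> F" for e
    using other_fractional_summand[OF _ outs, of "fst e" e] that finA nonneg parc_ends
    by (auto simp: F_def)
  moreover have "\<exists>f\<in>F. f \<noteq> e \<and> snd f = snd e" if "e \<in> F" for e
    using other_fractional_summand[OF _ ins, of "snd e" e] that finA nonneg parc_ends
    by (auto simp: F_def)
  ultimately have "\<exists>d :: 'a \<times> 'a \<Rightarrow> real. (\<exists>e. d e \<noteq> 0) \<and> (\<forall>e. e \<notin> F \<longrightarrow> d e = 0) \<and>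
    (\<forall>i. (\<Sum>e | e \<in> F \<and> fst e = i. d e) = 0) \<and> (\<forall>i. (\<Sum>e | e \<in> F \<and> snd e = i. d e) = 0)"
    by (rule exists_zero_margin_perturbation)
  then obtain d0 :: "'a \<times> 'a \<Rightarrow> real" and e0 where d0: "d0 e0 \<noteq> 0" "\<And>e. e \<notin> F \<Longrightarrow> d0 e = 0"
    "\<And>i. (\<Sum>e | e \<in> F \<and> fst e = i. d0 e) = 0" "\<And>i. (\<Sum>e | e \<in> F \<and> snd e = i. d0 e) = 0"
    by blast
  define s :: real where "s = (if (\<Sum>e\<in>?A. w e * d0 e) \<le> 0 then 1 else -1)"
  define d where "d e = s * d0 e" for e
  have d_off: "d e = 0" if "e \<notin> F" for e using d0(2) that by (simp add: d_def)
  have restrict_F: "(\<Sum>e | e \<in> ?A \<and> P e. d e) = s * (\<Sum>e | e \<in> F \<and> P e. d0 e)" for P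
    unfolding sum_distrib_left d_def
    by (rule sum.mono_neutral_right) (use finA d0(2) in \<open>auto simp: F_def\<close>)
  have d_out: "(\<Sum>e | e \<in> ?A \<and> fst e = i. d e) = 0"
    and d_in: "(\<Sum>e | e \<in> ?A \<and> snd e = i. d e) = 0" for i
    by (simp_all add: restrict_F d0)
  have "(\<Sum>e\<in>?A. w e * d e) = s * (\<Sum>e\<in>?A. w e * d0 e)"
    by (simp add: d_def sum_distrib_left mult_ac)
  then have wd: "(\<Sum>e\<in>?A. w e * d e) \<le> 0" by (auto simp: s_def)
  have "d e0 \<noteq> 0" using d0(1) by (simp add: d_def s_def)
  then have e0: "e0 \<in> F" "d e0 \<noteq> 0" using d_off by blast+
  define N where "N = {e \<in> F. d e < 0}"
  have d_nonneg: "0 \<le> d e" if "e \<notin> N" for e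
    using that d_off[of e] by (cases "e \<in> F") (auto simp: N_def)
  \<comment> \<open>A nonzero perturbation whose margins vanish takes a negative value.\<close>
  have "N \<noteq> {}"
  proof
    assume "N = {}"
    then have "0 \<le> d e" for e using d_nonneg by simp
    then have "d e0 = 0"
      using e0 finA by (intro sum_nonneg_0[OF _ _ d_out[of "fst e0"]]) (auto simp: F_def)
    with e0 show False by simp
  qed
  have finN: "finite N" using finA by (simp add: N_def F_def)
  \<comment> \<open>The largest step that keeps all values nonnegative.\<close>
  define t where "t = Min ((\<lambda>e. x e / - d e) ` N)"
  have t_le: "t \<le> x e / - d e" if "e \<in> N" for e
    unfolding t_def using finN that by auto
  have "t \<in> (\<lambda>e. x e / - d e) ` N"
    unfolding t_def using finN \<open>N \<noteq> {}\<close> by (intro Min_in) auto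
  then obtain e2 where e2: "e2 \<in> N" "t = x e2 / - d e2" by auto
  have t_pos: "0 < t" using e2 by (auto simp: N_def F_def divide_pos_neg)
  define x' where "x' e = x e + t * d e" for e
  show ?thesis
  proof
    have "0 \<le> x' e" if "e \<in> ?A" for e
    proof (cases "e \<in> N")
      case True
      then have "t * - d e \<le> x e"
        using t_le[OF True] by (subst (asm) pos_le_divide_eq) (auto simp: N_def)
      then show ?thesis by (simp add: x'_def)
    next
      case False
      show ?thesis using d_nonneg[OF False] nonneg that t_pos by (simp add: x'_def)
    qed
    then show "x' \<in> fractional_covers G"
      using outs ins d_out d_in
      by (auto simp: fractional_covers_def out_arcs_eq in_arcs_eq x'_def sum.distrib
          simp flip: sum_distrib_left)
    have "x' e = 0" if "e \<in> ?A" "x e = 0" for e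
      using that d_off[of e] by (simp add: x'_def F_def)
    moreover have "e2 \<in> ?A" "x e2 \<noteq> 0" "x' e2 = 0"
      using e2 by (auto simp: N_def F_def x'_def)
    ultimately show "{e \<in> ?A. x' e \<noteq> 0} \<subset> {e \<in> ?A. x e \<noteq> 0}" by blast
    have "(\<Sum>e\<in>?A. w e * x' e) = (\<Sum>e\<in>?A. w e * x e) + t * (\<Sum>e\<in>?A. w e * d e)"
      by (simp add: x'_def algebra_simps sum.distrib sum_distrib_left)
    also have "\<dots> \<le> (\<Sum>e\<in>?A. w e * x e)"
      using wd t_pos by (simp add: mult_le_0_iff)
    finally show "(\<Sum>e\<in>?A. w e * x' e) \<le> (\<Sum>e\<in>?A. w e * x e)" .
  qed
qed

text \<open>
  This is the form in which the integrality of the assignment polytope is needed: a linear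
  function is minimized by a cycle cover, which can moreover be taken in the face determined
  by the zeros of \<open>x\<close>. The support condition later forces the cover to use a prescribed arc.
\<close>

lemma fractional_cover_rounding:
  fixes w :: "'a \<times> 'a \<Rightarrow> real"
  assumes "x \<in> fractional_covers G"
  shows "\<exists>z\<in>cycle_covers G. (\<forall>e\<in>parcs G. x e = 0 \<longrightarrow> z e = 0) \<and>
    (\<Sum>e\<in>parcs G. w e * z e) \<le> (\<Sum>e\<in>parcs G. w e * x e)"
  using assms
proof (induction "card {e \<in> parcs G. x e \<noteq> 0}" arbitrary: x rule: less_induct)
  case less
  have finA: "finite (parcs G)" by (rule pair_finite_arcs)
  show ?case
  proof (cases "\<exists>e\<in>parcs G. x e \<noteq> 0 \<and> x e \<noteq> 1")
    case True
    obtain x' where x': "x' \<in> fractional_covers G"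
      "{e \<in> parcs G. x' e \<noteq> 0} \<subset> {e \<in> parcs G. x e \<noteq> 0}"
      "(\<Sum>e\<in>parcs G. w e * x' e) \<le> (\<Sum>e\<in>parcs G. w e * x e)"
      by (rule fractional_cover_improvement[OF less.prems True])
    have "card {e \<in> parcs G. x' e \<noteq> 0} < card {e \<in> parcs G. x e \<noteq> 0}"
      using finA x'(2) by (intro psubset_card_mono) auto
    from less.hyps[OF this x'(1)] x'(2,3) show ?thesis
      by (smt (verit) mem_Collect_eq psubsetD)
  next
    case False
    have "sum (restrict x (parcs G)) S = sum x S" if "S \<subseteq> parcs G" for S
      using that by (intro sum.cong) auto
    then have "restrict x (parcs G) \<in> cycle_covers G"
      using less.prems False
      by (auto simp: cycle_covers_def fractional_covers_def out_arcs_eq in_arcs_eq)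
    then show ?thesis by (intro bexI[of _ "restrict x (parcs G)"]) auto
  qed
qed

section \<open>The Gilmore-Lawler coefficients\<close>

lemma finite_cycle_covers: "finite (cycle_covers G)"
proof -
  have "finite (parcs G \<rightarrow>\<^sub>E {0, 1::real})"
    by (intro finite_PiE pair_finite_arcs) auto
  then show ?thesis by (rule finite_subset[rotated]) (auto simp: cycle_covers_def)
qed

lemma cycle_cover_0_1: "x \<in> cycle_covers G \<Longrightarrow> e \<in> parcs G \<Longrightarrow> x e = 0 \<or> x e = 1"
  by (auto simp: cycle_covers_def PiE_iff)

lemma gl_coeff_le:
  assumes "x \<in> cycle_covers G" "x e = 1"
  shows "gl_coeff G Q e \<le> (\<Sum>f\<in>parcs G. Q e f * x f)"
  using assms finite_cycle_covers by (auto simp: gl_coeff_def intro!: Min_le)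

lemma gl_coeff_attained:
  assumes "x \<in> cycle_covers G" "x e = 1"
  shows "\<exists>c\<in>cycle_covers G. c e = 1 \<and> (\<Sum>f\<in>parcs G. Q e f * c f) = gl_coeff G Q e"
proof -
  let ?C = "{x \<in> cycle_covers G. x e = 1}"
  have "Min ((\<lambda>x. \<Sum>f\<in>parcs G. Q e f * x f) ` ?C) \<in> (\<lambda>x. \<Sum>f\<in>parcs G. Q e f * x f) ` ?C"
    using assms finite_cycle_covers by (intro Min_in) auto
  then show ?thesis using assms by (auto simp: gl_coeff_def)
qed

text \<open>
  The hypotheses are the constraints of the linear program on the row of \<open>e\<close>. If \<open>y e > 0\<close>,
  then \<open>y / y e\<close> is a fractional cycle cover with value \<open>1\<close> at \<open>e\<close>. It vanishes on the other arcs
  leaving the tail of \<open>e\<close>, so rounding it gives a cycle cover through \<open>e\<close>, whose cost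
  bounds the coefficient of \<open>e\<close> from above. In particular the coefficient is not the default
  value \<open>0\<close> for an arc on no cycle cover.
\<close>

lemma gl_coeff_mult_le_scaled_cover:
  fixes y :: "'a \<times> 'a \<Rightarrow> real"
  assumes e: "e \<in> parcs G" and nonneg: "\<And>f. f \<in> parcs G \<Longrightarrow> 0 \<le> y f"
    and outs: "\<And>i. i \<in> pverts G \<Longrightarrow> (\<Sum>f\<in>out_arcs G i. y f) = y e"
    and ins: "\<And>i. i \<in> pverts G \<Longrightarrow> (\<Sum>f\<in>in_arcs G i. y f) = y e"
  shows "gl_coeff G Q e * y e \<le> (\<Sum>f\<in>parcs G. Q e f * y f)"
proof (cases "y e = 0")
  case True
  have "y f = 0" if f: "f \<in> parcs G" for f
  proof -
    have "sum y (out_arcs G (fst f)) = 0"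
      using outs parc_ends[OF f] True by simp
    then have "\<forall>g\<in>out_arcs G (fst f). y g = 0"
      using nonneg pair_finite_arcs
      by (subst (asm) sum_nonneg_eq_0_iff) (auto simp: out_arcs_eq)
    moreover have "f \<in> out_arcs G (fst f)" using f unfolding out_arcs_eq by simp
    ultimately show ?thesis by blast
  qed
  then show ?thesis using True by simp
next
  case False
  then have pos: "0 < y e" using nonneg e by fastforce
  define u where "u f = y f / y e" for f
  have "u \<in> fractional_covers G"
    using pos nonneg outs ins by (auto simp: fractional_covers_def u_def simp flip: sum_divide_distrib)
  then obtain z where z: "z \<in> cycle_covers G" "\<forall>f\<in>parcs G. u f = 0 \<longrightarrow> z f = 0"
    "(\<Sum>f\<in>parcs G. Q e f * z f) \<le> (\<Sum>f\<in>parcs G. Q e f * u f)"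
    using fractional_cover_rounding[of u "Q e"] by blast
  let ?S = "out_arcs G (fst e)"
  have S: "e \<in> ?S" "finite ?S" "fst e \<in> pverts G" "?S \<subseteq> parcs G"
    using e parc_ends pair_finite_arcs by (auto simp: out_arcs_eq)
  have rest: "sum y (?S - {e}) = 0"
    using outs[OF S(3)] S(1,2) by (simp add: sum.remove)
  have "z f = 0" if f: "f \<in> ?S - {e}" for f
  proof -
    have "y f = 0"
      using rest f nonneg S by (subst (asm) sum_nonneg_eq_0_iff) auto
    then show ?thesis using z(2) f S(4) by (auto simp: u_def)
  qed
  moreover have "sum z ?S = 1" using z(1) S(3) by (simp add: cycle_covers_def)
  ultimately have "z e = 1" using S(1,2) by (simp add: sum.remove)
  have "gl_coeff G Q e * y e \<le> (\<Sum>f\<in>parcs G. Q e f * z f) * y e"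
    using gl_coeff_le[OF z(1) \<open>z e = 1\<close>] pos by simp
  also have "\<dots> \<le> (\<Sum>f\<in>parcs G. Q e f * u f) * y e"
    using z(3) pos by simp
  also have "\<dots> = (\<Sum>f\<in>parcs G. Q e f * y f)"
    using pos by (simp add: sum_distrib_right u_def)
  finally show ?thesis .
qed

section \<open>Equality of the two bounds\<close>

text \<open>
  Each row of \<open>y\<close> costs at least the coefficient of its arc times \<open>x e\<close>; what remains is a
  linear cost on the fractional cycle cover \<open>x\<close>, to which rounding applies once more.
\<close>

lemma v_GL_le_cgl_objective:
  assumes "(x, y) \<in> cgl_feasible G"
  shows "v_GL G Q \<le> ereal (\<Sum>e\<in>parcs G. \<Sum>f\<in>parcs G. Q e f * y e f)"
proof -
  let ?z = "gl_coeff G Q"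
  have "x \<in> fractional_covers G"
    using assms by (auto simp: cgl_feasible_def fractional_covers_def PiE_iff)
  then obtain c where c: "c \<in> cycle_covers G"
    "(\<Sum>e\<in>parcs G. ?z e * c e) \<le> (\<Sum>e\<in>parcs G. ?z e * x e)"
    using fractional_cover_rounding[of x ?z] by blast
  have "v_GL G Q \<le> ereal (\<Sum>e\<in>parcs G. ?z e * c e)"
    using c(1) finite_cycle_covers by (auto simp: v_GL_def intro!: Min_le)
  also have "\<dots> \<le> ereal (\<Sum>e\<in>parcs G. ?z e * x e)" using c(2) by simp
  also have "(\<Sum>e\<in>parcs G. ?z e * x e) \<le> (\<Sum>e\<in>parcs G. \<Sum>f\<in>parcs G. Q e f * y e f)"
  proof (rule sum_mono)
    fix e assume e: "e \<in> parcs G"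
    then have "x e = y e e" using assms by (simp add: cgl_feasible_def)
    moreover have "?z e * y e e \<le> (\<Sum>f\<in>parcs G. Q e f * y e f)"
      using assms e by (intro gl_coeff_mult_le_scaled_cover) (auto simp: cgl_feasible_def PiE_iff)
    ultimately show "?z e * x e \<le> (\<Sum>f\<in>parcs G. Q e f * y e f)" by simp
  qed
  finally show ?thesis by simp
qed

text \<open>
  Take as row of each arc \<open>e\<close> on the cover a cycle cover that attains the coefficient of \<open>e\<close>
  (one exists, since \<open>x\<close> itself passes through \<open>e\<close>), and zero as row of every other arc.
\<close>

lemma cover_cost_attained_in_cgl:
  assumes x: "x \<in> cycle_covers G"
  shows "\<exists>y. (x, y) \<in> cgl_feasible G \<and>
    (\<Sum>e\<in>parcs G. \<Sum>f\<in>parcs G. Q e f * y e f) = (\<Sum>e\<in>parcs G. gl_coeff G Q e * x e)"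
proof -
  note x01 = cycle_cover_0_1[OF x]
  obtain c where c: "\<And>e. x e = 1 \<Longrightarrow> c e \<in> cycle_covers G \<and> c e e = 1 \<and>
      (\<Sum>f\<in>parcs G. Q e f * c e f) = gl_coeff G Q e"
    using gl_coeff_attained[OF x, where Q = Q] by metis
  define y where "y = (\<lambda>e\<in>parcs G. \<lambda>f\<in>parcs G. if x e = 1 then c e f else 0)"
  have y: "y e f = (if x e = 1 then c e f else 0)" if "e \<in> parcs G" "f \<in> parcs G" for e f
    using that by (simp add: y_def)
  have y_row: "(\<Sum>f\<in>S. g f * y e f) = (if x e = 1 then \<Sum>f\<in>S. g f * c e f else 0)"
    if "e \<in> parcs G" "S \<subseteq> parcs G" for e S g
  proof -
    have "(\<Sum>f\<in>S. g f * y e f) = (\<Sum>f\<in>S. g f * (if x e = 1 then c e f else 0))"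
      by (intro sum.cong refl arg_cong2[where f = "(*)"] y that(1)) (use that(2) in blast)
    then show ?thesis by simp
  qed
  have "x e = 1 \<Longrightarrow> f \<in> parcs G \<Longrightarrow> 0 \<le> c e f" for e f
    using c[of e] cycle_cover_0_1[of "c e" f] by auto
  then have "y \<in> parcs G \<rightarrow>\<^sub>E (parcs G \<rightarrow>\<^sub>E {0..})" by (auto simp: y_def)
  moreover have "x \<in> parcs G \<rightarrow>\<^sub>E {0..}"
  proof (rule PiE_I)
    show "x e \<in> {0..}" if "e \<in> parcs G" for e using x01[OF that] by auto
    show "x e = undefined" if "e \<notin> parcs G" for e
      using x that unfolding cycle_covers_def by (blast intro: PiE_arb)
  qed
  moreover have "(\<Sum>f\<in>out_arcs G i. y e f) = x e \<and> (\<Sum>f\<in>in_arcs G i. y e f) = x e"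
    if "i \<in> pverts G" "e \<in> parcs G" for i e
    using y_row[OF that(2), of "out_arcs G i" "\<lambda>_. 1"] y_row[OF that(2), of "in_arcs G i" "\<lambda>_. 1"]
      c[of e] x01[OF that(2)] that(1)
    by (auto simp: cycle_covers_def out_arcs_eq in_arcs_eq)
  moreover have "y e e = x e" if "e \<in> parcs G" for e
    using that y c x01[OF that] by auto
  ultimately have "(x, y) \<in> cgl_feasible G"
    using x by (simp add: cgl_feasible_def cycle_covers_def)
  moreover have "(\<Sum>f\<in>parcs G. Q e f * y e f) = gl_coeff G Q e * x e" if "e \<in> parcs G" for e
    using y_row[OF that order_refl, of "Q e"] c[of e] x01[OF that] by auto
  ultimately show ?thesis by (intro exI[of _ y]) simp
qed

lemma cgl_value_eq_v_GL: "cgl_value G Q = v_GL G Q"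
proof (rule antisym)
  show "v_GL G Q \<le> cgl_value G Q"
    unfolding cgl_value_def by (rule INF_greatest) (auto intro: v_GL_le_cgl_objective)
  show "cgl_value G Q \<le> v_GL G Q"
  proof (cases "cycle_covers G = {}")
    case True
    then show ?thesis by (simp add: v_GL_def)
  next
    case False
    let ?cost = "\<lambda>x. \<Sum>e\<in>parcs G. gl_coeff G Q e * x e"
    have "Min (?cost ` cycle_covers G) \<in> ?cost ` cycle_covers G"
      using False finite_cycle_covers by (intro Min_in) auto
    then obtain x where x: "x \<in> cycle_covers G" "v_GL G Q = ereal (?cost x)"
      using False by (auto simp: v_GL_def)
    obtain y where y: "(x, y) \<in> cgl_feasible G"
      "(\<Sum>e\<in>parcs G. \<Sum>f\<in>parcs G. Q e f * y e f) = ?cost x"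
      using cover_cost_attained_in_cgl[OF x(1)] by blast
    show ?thesis
      unfolding cgl_value_def using y x(2) by (intro INF_lower2[OF y(1)]) auto
  qed
qed

end

theorem theorem3:
  fixes G :: "'a pair_pre_digraph"
    and Q :: "'a \<times> 'a \<Rightarrow> 'a \<times> 'a \<Rightarrow> real"
  assumes "qccp_instance G Q"
  shows "cgl_value G Q = v_GL G Q"
proof -
  interpret qccp_instance G Q by fact
  show ?thesis by (rule cgl_value_eq_v_GL)
qed

end
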